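(* Let $g(z)=z+\sum_{n\ge 2}g_nz^n\in\mathbb{A}$, write $[n]_g=g_n$, and let $\phi(z)=1+B_1z+B_2z^2+\cdots$ be as in the context. If $f(z)=z+\sum_{n\ge2}a_nz^n\in\mathbb{A}$ belongs to $\mathcal{C}_g(\phi)$, then $$|a_2|\le\frac{B_1}{[2]_g([2]_g-1)},\qquad |a_3|\le\frac{B_1}{[3]_g([3]_g-1)}\max\left\{1,\left|\frac{B_2}{B_1}+\frac{B_1}{[2]_g-1}\right|\right\}.$$
   Context: $\mathbb{U}=\{z\in\mathbb{C}:|z|<1\}$, and $\mathbb{A}$ is the set of analytic functions $f$ on $\mathbb{U}$ with $f(0)=0$, $f'(0)=1$, i.e. $f(z)=z+\sum_{n\ge2}a_nz^n$. For analytic $F,\phi$ on $\mathbb{U}$, $F\prec\phi$ (subordination) means there is an analytic $u$ on $\mathbb{U}$ with $u(0)=0$, $|u(z)|<1$ and $F(z)=\phi(u(z))$ for all $z\in\mathbb{U}$. For $g(z)=z+\sum_{n\ge2}g_nz^n\in\mathbb{A}$, the $g$-derivative of $f\in\mathbb{A}$ is $D_gf(z)=\frac1z\left(z+\sum_{n\ge2}[n]_ga_nz^n\right)$, where $[n]_g=g_n$ (so $zD_gf\in\mathbb{A}$ is the convolution, i.e. Hadamard product, of $f$ and $g$). The function $\phi$ is analytic on $\mathbb{U}$ with positive real part, $\phi(0)=1$, $\phi'(0)>0$, $\phi(\mathbb{U})$ symmetric with respect to the real axis, with expansion $\phi(z)=1+B_1z+B_2z^2+B_3z^3+\cdots$,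 $B_1>0$. The class $\mathcal{C}_g(\phi)$ consists of all $f\in\mathbb{A}$ such that $\frac{D_g(zD_gf(z))}{D_gf(z)}\prec\phi(z)$.
   Formalization: The denominators [n]_g([n]_g−1) are replaced by their moduli, and each bound is claimed only when its denominators are nonzero; as written the claim fails, e.g. for g=z+z²/2, f=z, where the bound on |a_2| is −4B_1<0. *)

theory Defs
  imports "HOL-Complex_Analysis.Complex_Analysis"
begin

definition taylor_coeff :: "(complex \<Rightarrow> complex) \<Rightarrow> nat \<Rightarrow> complex" where
  "taylor_coeff f n = fps_nth (fps_expansion f 0) n"

definition normalized_analytic :: "(complex \<Rightarrow> complex) set" where
  "normalized_analytic = {f. f holomorphic_on ball 0 1 \<and> f 0 = 0 \<and> deriv f 0 = 1}"

definition subordinate :: "(complex \<Rightarrow> complex) \<Rightarrow> (complex \<Rightarrow> complex) \<Rightarrow> bool" where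
  "subordinate F \<phi> \<longleftrightarrow>
     (\<exists>u. u holomorphic_on ball 0 1 \<and> u 0 = 0 \<and>
          (\<forall>z\<in>ball 0 1. norm (u z) < 1 \<and> F z = \<phi> (u z)))"

(* The factor 1/z is cancelled termwise, so that the value at z = 0 is the intended one
   (namely 1) rather than the one dictated by division by zero. *)
definition g_deriv :: "(complex \<Rightarrow> complex) \<Rightarrow> (complex \<Rightarrow> complex) \<Rightarrow> complex \<Rightarrow> complex" where
  "g_deriv g f z = 1 + (\<Sum>n. taylor_coeff g (n + 2) * taylor_coeff f (n + 2) * z ^ (n + 1))"

(* No univalence is required, so only the first Taylor coefficient is asserted to be real. *)
definition admissible :: "(complex \<Rightarrow> complex) \<Rightarrow> bool" where
  "admissible \<phi> \<longleftrightarrow>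
     \<phi> holomorphic_on ball 0 1 \<and> (\<forall>z\<in>ball 0 1. 0 < Re (\<phi> z)) \<and>
     \<phi> 0 = 1 \<and> deriv \<phi> 0 \<in> \<real> \<and> 0 < Re (deriv \<phi> 0) \<and>
     cnj ` (\<phi> ` ball 0 1) = \<phi> ` ball 0 1"

(* For admissible \<phi>, subordination forces the quotient to be nonzero on the disc, so the
   denominator has no zeros there and the convention x / 0 = 0 plays no role. *)
definition class_C ::
    "(complex \<Rightarrow> complex) \<Rightarrow> (complex \<Rightarrow> complex) \<Rightarrow> (complex \<Rightarrow> complex) set" where
  "class_C g \<phi> = {f \<in> normalized_analytic.
     subordinate (\<lambda>z. g_deriv g (\<lambda>w. w * g_deriv g f w) z / g_deriv g f z) \<phi>}"

end

theory Submission
  imports Defs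
begin

text \<open>
  Write \<open>p\<close> for the \<open>g\<close>-derivative of \<open>f\<close> and \<open>q\<close> for the \<open>g\<close>-derivative of \<open>z p(z)\<close>.
  Applying the operator twice multiplies the coefficients by \<open>g\<^sub>n\<close> twice, so that
  \<open>p = 1 + x z + y z\<^sup>2 + \<dots>\<close> and \<open>q = 1 + g\<^sub>2 x z + g\<^sub>3 y z\<^sup>2 + \<dots>\<close> with \<open>x = g\<^sub>2 a\<^sub>2\<close>,
  \<open>y = g\<^sub>3 a\<^sub>3\<close>. Membership in the class says \<open>q = p \<cdot> (\<phi> \<circ> u)\<close> for a Schwarz function
  \<open>u = c\<^sub>1 z + c\<^sub>2 z\<^sup>2 + \<dots>\<close>. Comparing the coefficients of \<open>z\<close> and \<open>z\<^sup>2\<close> gives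
  \<open>(g\<^sub>2 - 1) x = B\<^sub>1 c\<^sub>1\<close> and \<open>(g\<^sub>3 - 1) y = x B\<^sub>1 c\<^sub>1 + B\<^sub>1 c\<^sub>2 + B\<^sub>2 c\<^sub>1\<^sup>2\<close>, and after
  elimination of \<open>x\<close> the latter becomes \<open>(g\<^sub>3 - 1) y = B\<^sub>1 (c\<^sub>2 + t c\<^sub>1\<^sup>2)\<close> with
  \<open>t = B\<^sub>2 / B\<^sub>1 + B\<^sub>1 / (g\<^sub>2 - 1)\<close>.

  The theorem follows from \<open>|c\<^sub>1| \<le> 1\<close> and \<open>|c\<^sub>2 + t c\<^sub>1\<^sup>2| \<le> max 1 |t|\<close>
  (\<open>Schwarz_function_functional_bound\<close>). The second bound rests on the sharp inequality
  \<open>|c\<^sub>2| \<le> 1 - |c\<^sub>1|\<^sup>2\<close>, which is the Schwarz--Pick inequality at the origin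
  (\<open>Schwarz_Pick_at_0\<close>) for \<open>u(z) / z\<close>: it makes \<open>|c\<^sub>2 + t c\<^sub>1\<^sup>2|\<close> at most a convex
  combination of \<open>1\<close> and \<open>|t|\<close>.

  The comparison of coefficients needs only the germs at the origin: as \<open>p(0) = 1\<close>, the quotient
  \<open>q / p\<close> may be cleared of its denominator in a neighbourhood of \<open>0\<close>.
\<close>

section \<open>Coefficients of Schwarz functions\<close>

text \<open>
  If \<open>|v|\<close> attains the value \<open>1\<close>, the maximum principle makes \<open>v\<close> constant. Otherwise the
  automorphism of the disc that sends \<open>v 0\<close> to \<open>0\<close> can be composed with \<open>v\<close>, and the
  Schwarz lemma bounds the derivative \<open>v' 0 / (1 - |v 0|\<^sup>2)\<close> of the composition.
\<close>
lemma Schwarz_Pick_at_0: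
  assumes hol: "v holomorphic_on ball 0 1"
    and le: "\<And>z. norm z < 1 \<Longrightarrow> norm (v z) \<le> 1"
  shows "norm (deriv v 0) \<le> 1 - (norm (v 0))\<^sup>2"
proof (cases "\<exists>z. norm z < 1 \<and> norm (v z) = 1")
  case True
  then obtain \<xi> where \<xi>: "norm \<xi> < 1" "norm (v \<xi>) = 1" by blast
  have "v constant_on ball 0 1"
    by (rule maximum_modulus_principle[where U = "ball 0 1" and \<xi> = \<xi>]) (use hol \<xi> le in auto)
  then obtain c where c: "\<And>z. z \<in> ball 0 1 \<Longrightarrow> v z = c"
    unfolding constant_on_def by blast
  have "(v has_field_derivative 0) (at 0)"
    by (rule has_field_derivative_transform_within_open[of "\<lambda>_. c" 0 0 "ball 0 1"]) (auto simp: c)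
  then have "deriv v 0 = 0" by (rule DERIV_imp_deriv)
  moreover have "norm (v 0) = 1" using c[of 0] c[of \<xi>] \<xi> by simp
  ultimately show ?thesis by simp
next
  case False
  then have lt: "norm (v z) < 1" if "norm z < 1" for z
    using le[OF that] that by fastforce
  define c where "c = v 0"
  have c1: "norm c < 1" unfolding c_def by (rule lt) simp
  define w where "w = Moebius_function 0 c \<circ> v"
  have w_eq: "w z = (v z - c) / (1 - cnj c * v z)" for z
    by (simp add: w_def Moebius_function_simple)
  have hol_w: "w holomorphic_on ball 0 1" unfolding w_def
    by (rule holomorphic_on_compose_gen[OF hol Moebius_function_holomorphic[OF c1]])
       (use lt in auto)
  have w0: "w 0 = 0" by (simp add: w_eq c_def)
  have w1: "norm (w z) < 1" if "norm z < 1" for z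
    unfolding w_def by (simp add: Moebius_function_norm_lt_1[OF c1 lt[OF that]])
  have le1: "norm (deriv w 0) \<le> 1"
    using Schwarz_Lemma(2)[OF hol_w w0 w1, of 0] by simp
  have den: "1 - cnj c * c = of_real (1 - (norm c)\<^sup>2)"
    using complex_norm_square[of c] by (simp add: mult.commute)
  have pos: "1 - (norm c)\<^sup>2 > 0" using c1 by (simp add: power_less_one_iff abs_square_less_1)
  then have nz: "1 - cnj c * c \<noteq> 0" unfolding den by (metis of_real_eq_0_iff less_irrefl)
  have dv: "(v has_field_derivative deriv v 0) (at 0)"
    by (rule holomorphic_derivI[OF hol]) auto
  have "((\<lambda>z. (v z - c) / (1 - cnj c * v z)) has_field_derivative
      (deriv v 0 * (1 - cnj c * v 0) - (v 0 - c) * (- (cnj c * deriv v 0))) /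
      ((1 - cnj c * v 0) * (1 - cnj c * v 0))) (at 0)"
    by (rule DERIV_divide) (use nz in \<open>auto intro!: derivative_eq_intros dv simp: c_def\<close>)
  then have "(w has_field_derivative deriv v 0 / (1 - cnj c * c)) (at 0)"
    using nz by (simp add: w_eq[abs_def] c_def)
  then have "deriv w 0 = deriv v 0 / (1 - cnj c * c)" by (rule DERIV_imp_deriv)
  then have "norm (deriv v 0) / (1 - (norm c)\<^sup>2) \<le> 1"
    using le1 pos unfolding den by (simp add: norm_divide del: of_real_diff)
  then show ?thesis using pos by (simp add: c_def)
qed

text \<open>
  By the Schwarz lemma \<open>v(z) = u(z) / z\<close> is bounded by \<open>1\<close>, and its first two coefficients
  are those of \<open>u\<close> shifted by one, so the bounds are \<open>|v 0| \<le> 1\<close> and Schwarz--Pick for \<open>v\<close>.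
\<close>
lemma Schwarz_function_coeff_bounds:
  assumes hol: "u holomorphic_on ball 0 1" and u0: "u 0 = 0"
    and lt: "\<And>z. norm z < 1 \<Longrightarrow> norm (u z) < 1"
  shows "norm (taylor_coeff u 1) \<le> 1"
    and "norm (taylor_coeff u 2) \<le> 1 - (norm (taylor_coeff u 1))\<^sup>2"
proof -
  obtain v where v: "v holomorphic_on ball 0 1" "\<And>z. norm z < 1 \<Longrightarrow> u z = z * v z"
    "deriv u 0 = v 0"
    using Schwarz3[OF hol u0] by metis
  have le: "norm (v z) \<le> 1" if z: "norm z < 1" for z
  proof (cases "z = 0")
    case True
    then show ?thesis using Schwarz_Lemma(2)[OF hol u0 lt z] v(3) by simp
  next
    case False
    then show ?thesis using Schwarz_Lemma(1)[OF hol u0 lt z] v(2)[OF z] by (simp add: norm_mult)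
  qed
  have v_exp: "v has_fps_expansion fps_expansion v 0"
    by (rule has_fps_expansion_fps_expansion[OF _ _ v(1)]) auto
  have u_exp: "u has_fps_expansion fps_expansion u 0"
    by (rule has_fps_expansion_fps_expansion[OF _ _ hol]) auto
  have "eventually (\<lambda>z. z \<in> ball 0 1) (nhds (0::complex))"
    by (rule eventually_nhds_in_open) auto
  then have "eventually (\<lambda>z. u z = z * v z) (nhds 0)"
    by eventually_elim (simp add: v(2))
  then have "u has_fps_expansion fps_X * fps_expansion v 0"
    by (subst has_fps_expansion_cong[OF _ refl])
       (auto intro: has_fps_expansion_mult has_fps_expansion_fps_X v_exp)
  then have "fps_expansion u 0 = fps_X * fps_expansion v 0"
    by (rule fps_expansion_unique_complex[OF u_exp])
  then have "taylor_coeff u 1 = v 0" "taylor_coeff u 2 = deriv v 0"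
    by (simp_all add: taylor_coeff_def fps_expansion_def numeral_2_eq_2)
  then show "norm (taylor_coeff u 1) \<le> 1"
    and "norm (taylor_coeff u 2) \<le> 1 - (norm (taylor_coeff u 1))\<^sup>2"
    using le[of 0] Schwarz_Pick_at_0[OF v(1) le] by simp_all
qed

text \<open>
  The bound \<open>(1 - |c\<^sub>1|\<^sup>2) + |t| |c\<^sub>1|\<^sup>2\<close> from the previous lemma is a convex combination
  of \<open>1\<close> and \<open>|t|\<close>. This inequality is due to Keogh and Merkes.
\<close>
lemma Schwarz_function_functional_bound:
  assumes "u holomorphic_on ball 0 1" "u 0 = 0" "\<And>z. norm z < 1 \<Longrightarrow> norm (u z) < 1"
  shows "norm (taylor_coeff u 2 + t * (taylor_coeff u 1)\<^sup>2) \<le> max 1 (norm t)"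
proof -
  define r where "r = (norm (taylor_coeff u 1))\<^sup>2"
  note bounds = Schwarz_function_coeff_bounds[OF assms]
  have r: "0 \<le> r" "r \<le> 1" using bounds(1) by (auto simp: r_def power_le_one)
  have "norm (taylor_coeff u 2 + t * (taylor_coeff u 1)\<^sup>2) \<le> (1 - r) + norm t * r"
    using bounds(2) by (intro norm_triangle_le add_mono) (auto simp: r_def norm_mult norm_power)
  also have "\<dots> \<le> (1 - r) * max 1 (norm t) + max 1 (norm t) * r"
  proof (rule add_mono)
    show "1 - r \<le> (1 - r) * max 1 (norm t)"
      using r mult_left_mono[of 1 "max 1 (norm t)" "1 - r"] by simp
    show "norm t * r \<le> max 1 (norm t) * r"
      using r by (intro mult_right_mono) auto
  qed
  also have "\<dots> = max 1 (norm t)" by (simp add: algebra_simps)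
  finally show ?thesis .
qed

section \<open>Hadamard products and the g-derivative\<close>

text \<open>
  At a common radius \<open>r\<close> of convergence the terms of one series are bounded and the other series
  converges absolutely, so the product series converges at \<open>r\<^sup>2\<close>.
\<close>
lemma Hadamard_product_conv_radius_pos:
  fixes F G :: "complex fps"
  assumes "fps_conv_radius F > 0" "fps_conv_radius G > 0"
  shows "fps_conv_radius (Abs_fps (\<lambda>n. fps_nth G n * fps_nth F n)) > 0"
proof -
  obtain s where s: "0 < s" "s < min (fps_conv_radius F) (fps_conv_radius G)"
    using dense[of 0 "min (fps_conv_radius F) (fps_conv_radius G)"] assms by auto
  then obtain r where r: "s = ereal r" by (cases s) auto
  have r0: "r > 0" using s r by simp
  have sumF: "summable (\<lambda>n. norm (fps_nth F n * complex_of_real r ^ n))"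
    using s r r0 by (intro abs_summable_in_conv_radius) (simp add: fps_conv_radius_def)
  have "summable (\<lambda>n. fps_nth G n * complex_of_real r ^ n)"
    using s r r0 by (intro summable_fps) simp
  then have "Bseq (\<lambda>n. fps_nth G n * complex_of_real r ^ n)"
    by (intro convergent_imp_Bseq convergentI) (rule summable_LIMSEQ_zero)
  then obtain M where M: "\<And>n. norm (fps_nth G n * complex_of_real r ^ n) \<le> M"
    by (auto simp: Bseq_def)
  have "norm (fps_nth G n * fps_nth F n * (complex_of_real (r * r)) ^ n)
      \<le> M * norm (fps_nth F n * complex_of_real r ^ n)" for n
  proof -
    have "fps_nth G n * fps_nth F n * (complex_of_real (r * r)) ^ n
      = (fps_nth G n * complex_of_real r ^ n) * (fps_nth F n * complex_of_real r ^ n)"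
      by (simp add: power_mult_distrib)
    then show ?thesis
      unfolding norm_mult[of "fps_nth G n * _"] by (metis M mult_right_mono norm_ge_zero norm_mult)
  qed
  then have "summable (\<lambda>n. fps_nth G n * fps_nth F n * (complex_of_real (r * r)) ^ n)"
    by (rule summable_comparison_test'[OF summable_mult[OF sumF], where N = 0])
  then have "conv_radius (\<lambda>n. fps_nth G n * fps_nth F n) \<ge> norm (complex_of_real (r * r))"
    by (rule conv_radius_geI)
  moreover have "ereal (norm (complex_of_real (r * r))) > 0" using r0 by simp
  ultimately have "conv_radius (\<lambda>n. fps_nth G n * fps_nth F n) > 0" by (rule less_le_trans[rotated])
  then show ?thesis by (simp add: fps_conv_radius_def)
qed

lemma taylor_coeff_eq_fps_nth:
  assumes "f has_fps_expansion F"
  shows "taylor_coeff f n = fps_nth F n"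
  using fps_nth_fps_expansion[OF assms, of n] by (simp add: taylor_coeff_def fps_expansion_def)

text \<open>
  The index shift is the factor \<open>1/z\<close> in front of the Hadamard product. Only germs of \<open>f\<close> and \<open>g\<close>
  enter, so that the operator can be applied again to \<open>z\<close> times its own output.
\<close>
lemma g_deriv_has_fps_expansion:
  assumes G: "g has_fps_expansion G" and F: "f has_fps_expansion F"
  shows "g_deriv g f has_fps_expansion
    Abs_fps (\<lambda>n. if n = 0 then 1 else fps_nth G (n + 1) * fps_nth F (n + 1))"
proof -
  define H where "H = fps_shift 2 (Abs_fps (\<lambda>n. fps_nth G n * fps_nth F n))"
  have pos: "fps_conv_radius H > 0"
    using Hadamard_product_conv_radius_pos[of F G] F G by (simp add: H_def has_fps_expansion_def)
  have "eventually (\<lambda>z. z \<in> eball 0 (fps_conv_radius H)) (nhds (0::complex))"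
    using pos by (intro eventually_nhds_in_open) (auto simp: zero_ereal_def)
  then have "eventually (\<lambda>z. 1 + z * eval_fps H z = g_deriv g f z) (nhds 0)"
  proof eventually_elim
    case (elim z)
    then have "(\<lambda>n. z * (fps_nth H n * z ^ n)) sums (z * eval_fps H z)"
      by (intro sums_mult sums_eval_fps) (simp add: in_eball_iff)
    also have "(\<lambda>n. z * (fps_nth H n * z ^ n)) =
        (\<lambda>n. taylor_coeff g (n + 2) * taylor_coeff f (n + 2) * z ^ (n + 1))"
      by (simp add: H_def taylor_coeff_eq_fps_nth[OF G] taylor_coeff_eq_fps_nth[OF F] mult_ac)
    finally show ?case by (simp add: g_deriv_def sums_iff)
  qed
  moreover have "1 + fps_X * H =
      Abs_fps (\<lambda>n. if n = 0 then 1 else fps_nth G (n + 1) * fps_nth F (n + 1))"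
    by (rule fps_ext) (auto simp: H_def fps_X_mult_nth)
  moreover have "(\<lambda>z. 1 + z * eval_fps H z) has_fps_expansion 1 + fps_X * H"
    by (intro fps_expansion_intros eval_fps_has_fps_expansion pos)
  ultimately show ?thesis using has_fps_expansion_cong[OF _ refl] by metis
qed

section \<open>Coefficient bounds for the class\<close>

lemma fps_compose_nth_1_2:
  fixes F U :: "'a :: comm_ring_1 fps"
  assumes "fps_nth U 0 = 0"
  shows "fps_nth (fps_compose F U) 1 = fps_nth F 1 * fps_nth U 1"
    and "fps_nth (fps_compose F U) 2 = fps_nth F 1 * fps_nth U 2 + fps_nth F 2 * (fps_nth U 1)\<^sup>2"
  using assms
  by (simp_all add: fps_compose_nth fps_mult_nth numeral_2_eq_2 power2_eq_square)

text \<open>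
  Both identities are comparisons of coefficients in \<open>q = p \<cdot> (\<phi> \<circ> u)\<close>, which is read as an
  identity of power series: it holds near the origin because \<open>p\<close> has constant coefficient \<open>1\<close>.
\<close>
lemma class_C_coeff_relations:
  assumes g: "g \<in> normalized_analytic"
    and \<phi>: "\<phi> holomorphic_on ball 0 1" "\<phi> 0 = 1"
    and f: "f \<in> class_C g \<phi>"
  obtains u where "u holomorphic_on ball 0 1" "u 0 = 0" "\<And>z. norm z < 1 \<Longrightarrow> norm (u z) < 1"
    and "taylor_coeff g 2 * taylor_coeff f 2 * (taylor_coeff g 2 - 1)
           = taylor_coeff \<phi> 1 * taylor_coeff u 1"
    and "taylor_coeff g 3 * taylor_coeff f 3 * (taylor_coeff g 3 - 1)
           = taylor_coeff g 2 * taylor_coeff f 2 * (taylor_coeff \<phi> 1 * taylor_coeff u 1)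
             + taylor_coeff \<phi> 1 * taylor_coeff u 2 + taylor_coeff \<phi> 2 * (taylor_coeff u 1)\<^sup>2"
proof -
  define p where "p = g_deriv g f"
  define q where "q = g_deriv g (\<lambda>w. w * p w)"
  obtain u where u: "u holomorphic_on ball 0 1" "u 0 = 0"
    and u1: "\<And>z. norm z < 1 \<Longrightarrow> norm (u z) < 1"
    and quot: "\<And>z. norm z < 1 \<Longrightarrow> q z / p z = \<phi> (u z)"
    using f by (auto simp: class_C_def subordinate_def p_def q_def)
  define G F \<Phi> U where "G = fps_expansion g 0" and "F = fps_expansion f 0"
    and "\<Phi> = fps_expansion \<phi> 0" and "U = fps_expansion u 0"
  note defs = G_def F_def \<Phi>_def U_def
  have exps: "g has_fps_expansion G" "f has_fps_expansion F" "\<phi> has_fps_expansion \<Phi>"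
    "u has_fps_expansion U"
    unfolding defs using g f \<phi> u(1)
    by (auto simp: normalized_analytic_def class_C_def
          intro!: has_fps_expansion_fps_expansion[of "ball 0 1"])
  have U0: "fps_nth U 0 = 0" and \<Phi>0: "fps_nth \<Phi> 0 = 1"
    using u(2) \<phi>(2) by (simp_all add: defs fps_expansion_def)
  define P where "P = Abs_fps (\<lambda>n. if n = 0 then 1 else fps_nth G (n + 1) * fps_nth F (n + 1))"
  define Q where "Q = Abs_fps (\<lambda>n. if n = 0 then 1
    else fps_nth G (n + 1) * fps_nth (fps_X * P) (n + 1))"
  have p: "p has_fps_expansion P"
    unfolding p_def P_def by (rule g_deriv_has_fps_expansion) (rule exps)+
  have q: "q has_fps_expansion Q"
    unfolding q_def Q_def
    by (rule g_deriv_has_fps_expansion) (intro exps fps_expansion_intros p)+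
  have "eventually (\<lambda>z. p z \<noteq> 0) (nhds 0)"
    using tendsto_imp_eventually_ne[OF has_fps_expansion_imp_tendsto_0[OF p], of 0]
    by (simp add: P_def)
  moreover have "eventually (\<lambda>z. z \<in> ball 0 1) (nhds (0::complex))"
    by (rule eventually_nhds_in_open) auto
  ultimately have "eventually (\<lambda>z. q z = p z * (\<phi> \<circ> u) z) (nhds 0)"
    by eventually_elim (simp flip: quot)
  moreover have "(\<lambda>z. p z * (\<phi> \<circ> u) z) has_fps_expansion P * fps_compose \<Phi> U"
    by (intro has_fps_expansion_mult has_fps_expansion_compose p exps U0)
  ultimately have "q has_fps_expansion P * fps_compose \<Phi> U"
    using has_fps_expansion_cong[OF _ refl] by metis
  then have Q: "Q = P * fps_compose \<Phi> U" by (rule fps_expansion_unique_complex[OF q])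
  have C0: "fps_nth (fps_compose \<Phi> U) 0 = 1" by (simp add: \<Phi>0)
  have mult1: "fps_nth (A * B) 1 = fps_nth A 0 * fps_nth B 1 + fps_nth A 1 * fps_nth B 0"
    and mult2: "fps_nth (A * B) 2
      = fps_nth A 0 * fps_nth B 2 + fps_nth A 1 * fps_nth B 1 + fps_nth A 2 * fps_nth B 0"
    for A B :: "complex fps"
    by (simp_all add: fps_mult_nth numeral_2_eq_2)
  have "fps_nth Q 1 = fps_nth P 1 + fps_nth \<Phi> 1 * fps_nth U 1"
    unfolding Q mult1 C0 fps_compose_nth_1_2[OF U0] by (simp add: P_def)
  then have rel1: "fps_nth G 2 * fps_nth F 2 * (fps_nth G 2 - 1) = fps_nth \<Phi> 1 * fps_nth U 1"
    by (simp add: Q_def P_def fps_X_mult_nth numeral_2_eq_2 algebra_simps)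
  have "fps_nth Q 2 = fps_nth P 2 + fps_nth P 1 * (fps_nth \<Phi> 1 * fps_nth U 1)
      + fps_nth \<Phi> 1 * fps_nth U 2 + fps_nth \<Phi> 2 * (fps_nth U 1)\<^sup>2"
    unfolding Q mult2 C0 fps_compose_nth_1_2[OF U0] by (simp add: P_def)
  then have rel2: "fps_nth G 3 * fps_nth F 3 * (fps_nth G 3 - 1)
      = fps_nth G 2 * fps_nth F 2 * (fps_nth \<Phi> 1 * fps_nth U 1)
        + fps_nth \<Phi> 1 * fps_nth U 2 + fps_nth \<Phi> 2 * (fps_nth U 1)\<^sup>2"
    by (simp add: Q_def P_def fps_X_mult_nth numeral_2_eq_2 numeral_3_eq_3 algebra_simps)
  show thesis
    by (rule that[OF u u1]) (use rel1 rel2 in \<open>simp_all add: taylor_coeff_def defs\<close>)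
qed

theorem theorem3p3:
  fixes f g \<phi> :: "complex \<Rightarrow> complex" and a gn B :: "nat \<Rightarrow> complex"
  defines "a \<equiv> taylor_coeff f" and "gn \<equiv> taylor_coeff g" and "B \<equiv> taylor_coeff \<phi>"
  assumes "g \<in> normalized_analytic"
    and "admissible \<phi>"
    and "f \<in> class_C g \<phi>"
  shows "(gn 2 \<notin> {0, 1} \<longrightarrow>
            norm (a 2) \<le> Re (B 1) / norm (gn 2 * (gn 2 - 1))) \<and>
         (gn 2 \<noteq> 1 \<and> gn 3 \<notin> {0, 1} \<longrightarrow>
            norm (a 3) \<le> Re (B 1) / norm (gn 3 * (gn 3 - 1)) *
                          max 1 (norm (B 2 / B 1 + B 1 / (gn 2 - 1))))"
proof -
  obtain u where u: "u holomorphic_on ball 0 1" "u 0 = 0" "\<And>z. norm z < 1 \<Longrightarrow> norm (u z) < 1"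
    and rel1: "gn 2 * a 2 * (gn 2 - 1) = B 1 * taylor_coeff u 1"
    and rel2: "gn 3 * a 3 * (gn 3 - 1) = gn 2 * a 2 * (B 1 * taylor_coeff u 1)
      + B 1 * taylor_coeff u 2 + B 2 * (taylor_coeff u 1)\<^sup>2"
    using class_C_coeff_relations[OF assms(4) _ _ assms(6)] assms(5)
    unfolding a_def gn_def B_def admissible_def by metis
  have B1: "B 1 \<in> \<real>" "0 < Re (B 1)"
    using assms(5) by (auto simp: admissible_def B_def taylor_coeff_def fps_expansion_def)
  then have normB: "norm (B 1) = Re (B 1)"
    by (simp add: in_Reals_norm complex_is_Real_iff)
  have nz: "B 1 \<noteq> 0" using B1 by auto
  have "norm (a 2) \<le> Re (B 1) / norm (gn 2 * (gn 2 - 1))" if "gn 2 \<notin> {0, 1}"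
  proof -
    have "norm (a 2) * norm (gn 2 * (gn 2 - 1)) = norm (B 1) * norm (taylor_coeff u 1)"
      using arg_cong[OF rel1, of norm] by (simp add: norm_mult mult_ac)
    also have "\<dots> \<le> Re (B 1)"
      using Schwarz_function_coeff_bounds(1)[OF u] B1 unfolding normB
      by (intro mult_left_le) auto
    finally show ?thesis using that by (simp add: pos_le_divide_eq)
  qed
  moreover have "norm (a 3) \<le> Re (B 1) / norm (gn 3 * (gn 3 - 1)) *
      max 1 (norm (B 2 / B 1 + B 1 / (gn 2 - 1)))" if "gn 2 \<noteq> 1" "gn 3 \<notin> {0, 1}"
  proof -
    define t where "t = B 2 / B 1 + B 1 / (gn 2 - 1)"
    have x: "gn 2 * a 2 = B 1 * taylor_coeff u 1 / (gn 2 - 1)"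
      using rel1 that(1) by (simp add: eq_divide_eq)
    have "gn 3 * a 3 * (gn 3 - 1) = B 1 * (taylor_coeff u 2 + t * (taylor_coeff u 1)\<^sup>2)"
      unfolding rel2 x t_def using nz that(1) by (simp add: field_simps power2_eq_square)
    then have "norm (a 3) * norm (gn 3 * (gn 3 - 1))
        = norm (B 1) * norm (taylor_coeff u 2 + t * (taylor_coeff u 1)\<^sup>2)"
      by (metis (no_types, opaque_lifting) mult.assoc mult.commute norm_mult)
    also have "\<dots> \<le> Re (B 1) * max 1 (norm t)"
      unfolding normB
      by (rule mult_left_mono[OF Schwarz_function_functional_bound[OF u]]) (use B1 in auto)
    finally show ?thesis using that by (simp add: t_def pos_le_divide_eq)
  qed
  ultimately show ?thesis by blast
qed

end
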